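(* Let $\mathbb{X}$ be a reflexive strictly convex Banach space and let $n \in \mathbb{N}$. Let $f, g_1, \ldots, g_n \in \mathbb{X}^{*}$ be such that $g_1, \ldots, g_n$ are linearly independent and $f \notin \mathbb{Z}$, where $\mathbb{Z} = \mathrm{span}\{g_1, \ldots, g_n\}$. Then $$\mathrm{dist}(f, \mathbb{Z}) = \max\Big\{|f(x)| : x \in \bigcap_{i=1}^{n} \mathcal{N}(g_i) \cap S_{\mathbb{X}}\Big\}.$$
   Context: All Banach spaces are real; $\mathbb{X}^*$ is the dual space with its usual norm, $S_{\mathbb{X}}$ the unit sphere and $B_{\mathbb{X}}$ the closed unit ball. $\mathbb{X}$ is strictly convex if every element of $S_{\mathbb{X}}$ is an extreme point of $B_{\mathbb{X}}$. For $h\in\mathbb{X}^*$, $\mathcal{N}(h)$ is the kernel of $h$. For an element $x$ and a subspace $\mathbb{V}$ of a Banach space, $\mathrm{dist}(x,\mathbb{V}) = \inf\{\|x-z\| : z\in\mathbb{V}\}$. *)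

theory Defs
  imports "HOL-Analysis.Analysis"
begin

type_synonym 'a dual = "'a \<Rightarrow>\<^sub>L real"

lift_definition canonical_embedding :: "'a::real_normed_vector \<Rightarrow> 'a dual dual"
  is "\<lambda>x h. blinfun_apply h x"
  by (rule blinfun.bounded_linear_left)

definition reflexive_space :: "'a::banach itself \<Rightarrow> bool" where
  "reflexive_space _ \<longleftrightarrow> surj (canonical_embedding :: 'a \<Rightarrow> 'a dual dual)"

definition strictly_convex_space :: "'a::real_normed_vector itself \<Rightarrow> bool" where
  "strictly_convex_space _ \<longleftrightarrow> (\<forall>x \<in> sphere (0::'a) 1. x extreme_point_of cball 0 1)"

definition functional_kernel :: "'a::real_normed_vector dual \<Rightarrow> 'a set" where
  "functional_kernel h = {x. blinfun_apply h x = 0}"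

(* Max is only meaningful on finite sets, and Sup does not record attainment. *)
definition is_max :: "'a::order \<Rightarrow> 'a set \<Rightarrow> bool" where
  "is_max m S \<longleftrightarrow> m \<in> S \<and> (\<forall>s \<in> S. s \<le> m)"

end

theory Submission imports Defs begin

text \<open>
  Write \<open>Z\<close> for the span and \<open>d\<close> for the distance from \<open>f\<close> to \<open>Z\<close>. If every
  \<open>g i\<close> vanishes at a unit vector \<open>x\<close>, then \<open>f x = (f - z) x\<close> for each \<open>z \<in> Z\<close>, so
  \<open>\<bar>f x\<bar> \<le> d\<close>.

  The bound is attained because of duality. The distance to \<open>Z\<close> is a sublinear function on the
  dual space, so the Hahn--Banach theorem (\<open>Hahn_Banach_norming\<close>) yields a linear functional \<open>F\<close>
  on the dual that is dominated by it and has \<open>F f = d\<close>. Domination gives \<open>F = 0\<close> on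
  \<open>Z\<close> and \<open>\<bar>F h\<bar> \<le> norm h\<close>, and by reflexivity \<open>F\<close> is evaluation at some \<open>x\<close>. The same
  theorem, applied to the norm of the underlying space, gives \<open>norm x \<le> 1\<close>. Since
  \<open>d = f x \<le> d * norm x\<close>, it remains to see that \<open>d > 0\<close>. If \<open>d = 0\<close>, then \<open>f\<close>
  would vanish on the common kernel of the \<open>g i\<close>, and would therefore be a linear combination of
  them (\<open>in_span_if_vanishes_on_kernels\<close>).

  The Hahn--Banach theorem itself rests on Zorn's lemma for sublinear functions ordered pointwise:
  a minimal sublinear function is linear.
\<close>

section \<open>Sublinear functions and the Hahn--Banach theorem\<close>

text \<open>Subadditive and positively homogeneous; allowing the factor 0 forces \<open>p 0 = 0\<close>.\<close>

definition sublinear :: "('a::real_vector \<Rightarrow> real) \<Rightarrow> bool" where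
  "sublinear p \<longleftrightarrow> (\<forall>x y. p (x + y) \<le> p x + p y) \<and> (\<forall>t\<ge>0. \<forall>x. p (t *\<^sub>R x) = t * p x)"

lemma sublinearI:
  assumes "\<And>x y. p (x + y) \<le> p x + p y" and "\<And>t x. t \<ge> 0 \<Longrightarrow> p (t *\<^sub>R x) = t * p x"
  shows "sublinear p"
  using assms by (simp add: sublinear_def)

lemma sublinear_add: "sublinear p \<Longrightarrow> p (x + y) \<le> p x + p y"
  by (simp add: sublinear_def)

lemma sublinear_scale: "sublinear p \<Longrightarrow> t \<ge> 0 \<Longrightarrow> p (t *\<^sub>R x) = t * p x"
  by (simp add: sublinear_def)

lemma sublinear_zero: "sublinear p \<Longrightarrow> p 0 = 0"
  using sublinear_scale[of p 0 0] by simp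

lemma sublinear_minus: "sublinear p \<Longrightarrow> - p (- x) \<le> p x"
  using sublinear_add[of p x "- x"] sublinear_zero[of p] by simp

text \<open>Given \<open>p 0 = 0\<close>, one inequality for positive factors suffices for positive homogeneity: the
reverse one follows by scaling back with the inverse factor.\<close>

lemma sublinearI_pos:
  assumes add: "\<And>x y. p (x + y) \<le> p x + p y"
    and scale: "\<And>t x. t > 0 \<Longrightarrow> p (t *\<^sub>R x) \<le> t * p x"
    and zero: "p 0 = 0"
  shows "sublinear p"
proof (rule sublinearI)
  fix t :: real and x :: 'a
  assume "t \<ge> 0"
  show "p (t *\<^sub>R x) = t * p x"
  proof (cases "t = 0")
    case True
    then show ?thesis by (simp add: zero)
  next
    case False
    with \<open>t \<ge> 0\<close> have t: "t > 0" by simp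
    have "p x \<le> inverse t * p (t *\<^sub>R x)"
      using scale[of "inverse t" "t *\<^sub>R x"] t by simp
    then have "t * p x \<le> p (t *\<^sub>R x)"
      using t by (simp add: field_simps)
    then show ?thesis using scale[OF t, of x] by simp
  qed
qed (rule add)

text \<open>
  For sublinear \<open>p\<close>: the largest sublinear function below \<open>p\<close> whose value at \<open>- a\<close> is at most \<open>- p a\<close>.
\<close>

definition sublinear_reduct :: "('a::real_vector \<Rightarrow> real) \<Rightarrow> 'a \<Rightarrow> 'a \<Rightarrow> real" where
  "sublinear_reduct p a x = (INF t\<in>{0..}. p (x + t *\<^sub>R a) - t * p a)"

lemma sublinear_reduct_bdd_below:
  assumes "sublinear p"
  shows "bdd_below ((\<lambda>t. p (x + t *\<^sub>R a) - t * p a) ` {0..})"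
proof (rule bdd_belowI2)
  fix t :: real
  assume "t \<in> {0..}"
  then show "- p (- x) \<le> p (x + t *\<^sub>R a) - t * p a"
    using sublinear_add[OF assms, of "x + t *\<^sub>R a" "- x"] sublinear_scale[OF assms, of t a]
    by simp
qed

lemma sublinear_reduct_le:
  assumes "sublinear p" and "t \<ge> 0"
  shows "sublinear_reduct p a x \<le> p (x + t *\<^sub>R a) - t * p a"
  unfolding sublinear_reduct_def
  by (rule cINF_lower[OF sublinear_reduct_bdd_below]) (use assms in auto)

lemma sublinear_reduct_greatest:
  assumes "\<And>t. t \<ge> 0 \<Longrightarrow> m \<le> p (x + t *\<^sub>R a) - t * p a"
  shows "m \<le> sublinear_reduct p a x"
  unfolding sublinear_reduct_def by (rule cINF_greatest) (use assms in auto)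

lemma sublinear_reduct_le_self:
  assumes "sublinear p"
  shows "sublinear_reduct p a x \<le> p x"
  using sublinear_reduct_le[OF assms, of 0] by simp

lemma sublinear_sublinear_reduct:
  assumes p: "sublinear p"
  shows "sublinear (sublinear_reduct p a)"
proof (rule sublinearI_pos)
  fix x y
  have "sublinear_reduct p a (x + y) - sublinear_reduct p a y \<le> sublinear_reduct p a x"
  proof (rule sublinear_reduct_greatest)
    fix t :: real
    assume t: "t \<ge> 0"
    have "sublinear_reduct p a (x + y) - (p (x + t *\<^sub>R a) - t * p a) \<le> sublinear_reduct p a y"
    proof (rule sublinear_reduct_greatest)
      fix s :: real
      assume s: "s \<ge> 0"
      show "sublinear_reduct p a (x + y) - (p (x + t *\<^sub>R a) - t * p a)
          \<le> p (y + s *\<^sub>R a) - s * p a"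
        using sublinear_reduct_le[OF p, of "t + s" a "x + y"] s t
          sublinear_add[OF p, of "x + t *\<^sub>R a" "y + s *\<^sub>R a"]
        by (simp add: algebra_simps)
    qed
    then show "sublinear_reduct p a (x + y) - sublinear_reduct p a y
        \<le> p (x + t *\<^sub>R a) - t * p a" by simp
  qed
  then show "sublinear_reduct p a (x + y) \<le> sublinear_reduct p a x + sublinear_reduct p a y"
    by simp
next
  fix t :: real and x
  assume t: "t > 0"
  have "inverse t * sublinear_reduct p a (t *\<^sub>R x) \<le> sublinear_reduct p a x"
  proof (rule sublinear_reduct_greatest)
    fix s :: real
    assume s: "s \<ge> 0"
    have "sublinear_reduct p a (t *\<^sub>R x) \<le> p (t *\<^sub>R x + (t * s) *\<^sub>R a) - (t * s) * p a"
      by (rule sublinear_reduct_le[OF p]) (use s t in simp)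
    also have "\<dots> = t * (p (x + s *\<^sub>R a) - s * p a)"
      using sublinear_scale[OF p, of t "x + s *\<^sub>R a"] t by (simp add: algebra_simps)
    finally show "inverse t * sublinear_reduct p a (t *\<^sub>R x) \<le> p (x + s *\<^sub>R a) - s * p a"
      using t by (simp add: field_simps)
  qed
  then show "sublinear_reduct p a (t *\<^sub>R x) \<le> t * sublinear_reduct p a x"
    using t by (simp add: field_simps)
next
  have "0 \<le> sublinear_reduct p a 0"
    by (rule sublinear_reduct_greatest) (simp add: sublinear_scale[OF p])
  then show "sublinear_reduct p a 0 = 0"
    using sublinear_reduct_le_self[OF p, of a 0] sublinear_zero[OF p] by simp
qed

text \<open>Minimality forces \<open>q\<close> to coincide with its reduct along any direction \<open>y\<close>; the
  parameter value 1 in that infimum then gives \<open>q x + q y \<le> q (x + y)\<close>.\<close>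

lemma sublinear_minimal_linear:
  assumes q: "sublinear q"
    and minimal: "\<And>r. sublinear r \<Longrightarrow> (\<And>x. r x \<le> q x) \<Longrightarrow> r = q"
  shows "linear q"
proof -
  have add: "q (x + y) = q x + q y" for x y
  proof (rule antisym)
    have "sublinear_reduct q y = q"
      by (rule minimal) (simp_all add: sublinear_sublinear_reduct sublinear_reduct_le_self q)
    then show "q x + q y \<le> q (x + y)"
      using sublinear_reduct_le[OF q, of 1 y x] by simp
  qed (rule sublinear_add[OF q])
  have minus: "q (- x) = - q x" for x
    using add[of x "- x"] sublinear_zero[OF q] by simp
  have "q (t *\<^sub>R x) = t * q x" for t x
  proof (cases "t \<ge> 0")
    case False
    then show ?thesis
      using sublinear_scale[OF q, of "- t" x] minus[of "t *\<^sub>R x"] by simp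
  qed (rule sublinear_scale[OF q])
  with add show ?thesis by (intro linearI) auto
qed

text \<open>The bound \<open>- p (- x) \<le> q x\<close> keeps the pointwise infimum finite. Subadditivity survives
  because any two members of a chain can be replaced by the smaller one.\<close>

lemma sublinear_chain_lower_bound:
  assumes ne: "C \<noteq> {}"
    and sub: "\<And>q. q \<in> C \<Longrightarrow> sublinear q"
    and below: "\<And>q x. q \<in> C \<Longrightarrow> q x \<le> p x"
    and chain: "\<And>q r. q \<in> C \<Longrightarrow> r \<in> C \<Longrightarrow> q \<le> r \<or> r \<le> q"
  shows "sublinear (\<lambda>x. INF q\<in>C. q x)" and "\<And>q x. q \<in> C \<Longrightarrow> (INF q\<in>C. q x) \<le> q x"
proof -
  have bdd: "bdd_below ((\<lambda>q. q x) ` C)" for x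
  proof (rule bdd_belowI2)
    fix q
    assume "q \<in> C"
    then show "- p (- x) \<le> q x"
      using sublinear_minus[OF sub, of q x] below[of q "- x"] by simp
  qed
  have le: "(INF q\<in>C. q x) \<le> q x" if "q \<in> C" for q x
    using bdd that by (rule cINF_lower)
  then show "\<And>q x. q \<in> C \<Longrightarrow> (INF q\<in>C. q x) \<le> q x" .
  show "sublinear (\<lambda>x. INF q\<in>C. q x)"
  proof (rule sublinearI_pos)
    fix x y
    have "(INF q\<in>C. q (x + y)) - (INF q\<in>C. q y) \<le> (INF q\<in>C. q x)"
    proof (rule cINF_greatest[OF ne])
      fix q
      assume q: "q \<in> C"
      have "(INF q\<in>C. q (x + y)) - q x \<le> (INF q\<in>C. q y)"
      proof (rule cINF_greatest[OF ne])
        fix r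
        assume r: "r \<in> C"
        from chain[OF q r] show "(INF q\<in>C. q (x + y)) - q x \<le> r y"
        proof
          assume "q \<le> r"
          then show ?thesis
            using le[OF q, of "x + y"] sublinear_add[OF sub[OF q], of x y] le_funD[of q r y] by simp
        next
          assume "r \<le> q"
          then show ?thesis
            using le[OF r, of "x + y"] sublinear_add[OF sub[OF r], of x y] le_funD[of r q x] by simp
        qed
      qed
      then show "(INF q\<in>C. q (x + y)) - (INF q\<in>C. q y) \<le> q x" by simp
    qed
    then show "(INF q\<in>C. q (x + y)) \<le> (INF q\<in>C. q x) + (INF q\<in>C. q y)" by simp
  next
    fix t :: real and x
    assume t: "t > 0"
    have "inverse t * (INF q\<in>C. q (t *\<^sub>R x)) \<le> (INF q\<in>C. q x)"
    proof (rule cINF_greatest[OF ne])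
      fix q
      assume q: "q \<in> C"
      show "inverse t * (INF q\<in>C. q (t *\<^sub>R x)) \<le> q x"
        using le[OF q, of "t *\<^sub>R x"] sublinear_scale[OF sub[OF q], of t x] t
        by (simp add: field_simps)
    qed
    then show "(INF q\<in>C. q (t *\<^sub>R x)) \<le> t * (INF q\<in>C. q x)"
      using t by (simp add: field_simps)
  next
    have "(INF q\<in>C. q 0) = (INF q\<in>C. 0)"
      by (rule INF_cong) (auto simp: sublinear_zero sub)
    then show "(INF q\<in>C. q 0) = 0" using ne by simp
  qed
qed

lemma Hahn_Banach_sublinear:
  assumes p: "sublinear p"
  obtains l where "linear l" and "\<And>x. l x \<le> p x"
proof -
  define A where "A = {q. sublinear q \<and> (\<forall>x. q x \<le> p x)}"
  have po: "partial_order_on A (relation_of (\<ge>) A)"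
    by (rule partial_order_on_relation_ofI) auto
  have "\<exists>m\<in>A. \<forall>q\<in>A. m \<ge> q \<longrightarrow> q = m"
  proof (rule predicate_Zorn[OF po])
    fix C
    assume C: "C \<in> Chains (relation_of (\<ge>) A)"
    show "\<exists>u\<in>A. \<forall>q\<in>C. q \<ge> u"
    proof (cases "C = {}")
      case True
      then show ?thesis using p by (auto simp: A_def)
    next
      case False
      have "C \<subseteq> A" and chain: "q \<le> r \<or> r \<le> q" if "q \<in> C" "r \<in> C" for q r
        using C that by (auto simp: Chains_def relation_of_def)
      with False have CA: "C \<subseteq> A" by blast
      define u where "u x = (INF q\<in>C. q x)" for x
      have "sublinear u" and le: "\<And>q x. q \<in> C \<Longrightarrow> u x \<le> q x"
        using sublinear_chain_lower_bound[of C p] False CA chain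
        unfolding u_def[abs_def] A_def by blast+
      moreover have "u x \<le> p x" for x
      proof -
        obtain q where "q \<in> C" using False by blast
        then have "u x \<le> q x" and "q x \<le> p x" using le CA by (auto simp: A_def)
        then show ?thesis by (rule order_trans)
      qed
      ultimately show ?thesis by (intro bexI[of _ u]) (auto simp: A_def le_fun_def)
    qed
  qed
  then obtain m where "m \<in> A" and min: "\<And>q. q \<in> A \<Longrightarrow> q \<le> m \<Longrightarrow> q = m"
    by blast
  have m: "sublinear m" and mp: "m x \<le> p x" for x
    using \<open>m \<in> A\<close> by (auto simp: A_def)
  have "linear m"
  proof (rule sublinear_minimal_linear[OF m])
    fix r
    assume "sublinear r" and "\<And>x. r x \<le> m x"
    then show "r = m"
      using mp by (intro min) (auto simp: A_def le_fun_def intro: order_trans)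
  qed
  then show ?thesis using that mp by blast
qed

text \<open>A linear function below the reduct of \<open>p\<close> along \<open>a\<close> is at most \<open>- p a\<close> at
  \<open>- a\<close>, hence at least \<open>p a\<close> at \<open>a\<close>.\<close>

theorem Hahn_Banach_norming:
  assumes p: "sublinear p"
  obtains l where "linear l" and "\<And>x. l x \<le> p x" and "l a = p a"
proof -
  obtain l where l: "linear l" and le: "\<And>x. l x \<le> sublinear_reduct p a x"
    using Hahn_Banach_sublinear[OF sublinear_sublinear_reduct[OF p, of a]] by blast
  have lp: "l x \<le> p x" for x
    using le[of x] sublinear_reduct_le_self[OF p, of a x] by simp
  have "l (- a) \<le> - p a"
    using le[of "- a"] sublinear_reduct_le[OF p, of 1 a "- a"] sublinear_zero[OF p] by simp
  then have "l a = p a"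
    using lp[of a] linear_neg[OF l, of a] by simp
  with l lp show ?thesis by (rule that)
qed

lemma linear_le_norm_bounded_linear:
  fixes l :: "'a::real_normed_vector \<Rightarrow> real"
  assumes l: "linear l" and le: "\<And>x. l x \<le> norm x"
  shows "bounded_linear l" and "\<bar>l x\<bar> \<le> norm x"
proof -
  show *: "\<bar>l x\<bar> \<le> norm x" for x
    using le[of x] le[of "- x"] linear_neg[OF l, of x] by simp
  show "bounded_linear l"
    by (rule bounded_linear.intro[OF l])
      (use * in \<open>auto simp: bounded_linear_axioms_def intro!: exI[of _ 1]\<close>)
qed

lemma norming_functional:
  fixes x :: "'a::real_normed_vector"
  obtains h :: "'a dual" where "norm h \<le> 1" and "blinfun_apply h x = norm x"
proof -
  have "sublinear (norm :: 'a \<Rightarrow> real)"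
    by (rule sublinearI) (auto simp: norm_triangle_ineq)
  then obtain l :: "'a \<Rightarrow> real" where l: "linear l" "\<And>y. l y \<le> norm y" "l x = norm x"
    using Hahn_Banach_norming[of norm x] by blast
  have "blinfun_apply (Blinfun l) = l"
    by (rule bounded_linear_Blinfun_apply) (rule linear_le_norm_bounded_linear[OF l(1,2)])
  moreover from this have "norm (Blinfun l) \<le> 1"
    using linear_le_norm_bounded_linear(2)[OF l(1,2)] by (intro norm_blinfun_bound) auto
  ultimately show ?thesis using that l(3) by metis
qed

section \<open>Distance to a subspace and common kernels\<close>

lemma le_infdistI:
  assumes "S \<noteq> {}" and "\<And>z. z \<in> S \<Longrightarrow> m \<le> dist x z"
  shows "m \<le> infdist x S"
  unfolding infdist_notempty[OF assms(1)] by (rule cINF_greatest) (use assms in auto)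

lemma sublinear_infdist:
  fixes S :: "'a::real_normed_vector set"
  assumes S: "subspace S"
  shows "sublinear (\<lambda>x. infdist x S)"
proof -
  have ne: "S \<noteq> {}" using subspace_0[OF S] by blast
  show ?thesis
  proof (rule sublinearI_pos)
    fix x y
    have "infdist (x + y) S - infdist y S \<le> infdist x S"
    proof (rule le_infdistI[OF ne])
      fix z
      assume z: "z \<in> S"
      have "infdist (x + y) S - dist x z \<le> infdist y S"
      proof (rule le_infdistI[OF ne])
        fix w
        assume w: "w \<in> S"
        have "infdist (x + y) S \<le> dist (x + y) (z + w)"
          by (rule infdist_le) (rule subspace_add[OF S z w])
        also have "\<dots> \<le> dist x z + dist y w" by (rule dist_triangle_add)
        finally show "infdist (x + y) S - dist x z \<le> dist y w" by simp
      qed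
      then show "infdist (x + y) S - infdist y S \<le> dist x z" by simp
    qed
    then show "infdist (x + y) S \<le> infdist x S + infdist y S" by simp
  next
    fix t :: real and x
    assume t: "t > 0"
    have "inverse t * infdist (t *\<^sub>R x) S \<le> infdist x S"
    proof (rule le_infdistI[OF ne])
      fix z
      assume "z \<in> S"
      then have "infdist (t *\<^sub>R x) S \<le> dist (t *\<^sub>R x) (t *\<^sub>R z)"
        by (intro infdist_le subspace_scale[OF S])
      also have "\<dots> = t * dist x z"
        using t by (simp add: dist_norm flip: scaleR_diff_right)
      finally have "infdist (t *\<^sub>R x) S \<le> t * dist x z" .
      then show "inverse t * infdist (t *\<^sub>R x) S \<le> dist x z"
        using t by (simp add: field_simps)
    qed
    then show "infdist (t *\<^sub>R x) S \<le> t * infdist x S"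
      using t by (simp add: field_simps)
  qed (rule infdist_zero[OF subspace_0[OF S]])
qed

text \<open>Elimination: a vector on which \<open>g\<close> is 1 and the functionals in \<open>G\<close> vanish allows
  \<open>f\<close> to be corrected by a multiple of \<open>g\<close> so as to vanish on the common kernel of \<open>G\<close>.\<close>

lemma in_span_if_vanishes_on_kernels:
  fixes f :: "'a::real_normed_vector dual"
  assumes "finite G"
    and "\<And>x. (\<forall>g\<in>G. blinfun_apply g x = 0) \<Longrightarrow> blinfun_apply f x = 0"
  shows "f \<in> span G"
  using assms
proof (induction G arbitrary: f rule: finite_induct)
  case empty
  then have "f = 0" by (intro blinfun_eqI) simp
  then show ?case by simp
next
  case (insert g G)
  show ?case
  proof (cases "\<forall>x. (\<forall>h\<in>G. blinfun_apply h x = 0) \<longrightarrow> blinfun_apply g x = 0")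
    case True
    then have "f \<in> span G" using insert.prems by (intro insert.IH) auto
    then show ?thesis using span_mono[of G "insert g G"] by blast
  next
    case False
    then obtain v where v: "\<forall>h\<in>G. blinfun_apply h v = 0" "blinfun_apply g v \<noteq> 0" by blast
    define u where "u = inverse (blinfun_apply g v) *\<^sub>R v"
    have u: "\<forall>h\<in>G. blinfun_apply h u = 0" "blinfun_apply g u = 1"
      using v by (auto simp: u_def blinfun.scaleR_right)
    have "f - blinfun_apply f u *\<^sub>R g \<in> span G"
    proof (rule insert.IH)
      fix x
      assume x: "\<forall>h\<in>G. blinfun_apply h x = 0"
      have "blinfun_apply f (x - blinfun_apply g x *\<^sub>R u) = 0"
        using x u by (intro insert.prems) (auto simp: blinfun.diff_right blinfun.scaleR_right)
      then show "blinfun_apply (f - blinfun_apply f u *\<^sub>R g) x = 0"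
        by (simp add: blinfun.diff_left blinfun.scaleR_left blinfun.diff_right blinfun.scaleR_right)
    qed
    then show ?thesis by (auto simp: span_insert)
  qed
qed

lemma vanishes_on_span:
  fixes x :: "'a::real_normed_vector"
  assumes "\<And>g. g \<in> G \<Longrightarrow> blinfun_apply g x = 0" and "h \<in> span G"
  shows "blinfun_apply h x = 0"
  using assms(2)
  by (induction rule: span_induct_alt) (auto simp: blinfun.add_left blinfun.scaleR_left assms(1))

lemma abs_apply_le_infdist_span:
  fixes f :: "'a::real_normed_vector dual"
  assumes "\<And>g. g \<in> G \<Longrightarrow> blinfun_apply g x = 0"
  shows "\<bar>blinfun_apply f x\<bar> \<le> infdist f (span G) * norm x"
proof (cases "x = 0")
  case False
  have "\<bar>blinfun_apply f x\<bar> / norm x \<le> infdist f (span G)"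
  proof (rule le_infdistI)
    fix z
    assume "z \<in> span G"
    then have "blinfun_apply f x = blinfun_apply (f - z) x"
      using vanishes_on_span[OF assms] by (simp add: blinfun.diff_left)
    then have "\<bar>blinfun_apply f x\<bar> \<le> dist f z * norm x"
      using norm_blinfun[of "f - z" x] by (simp add: dist_norm)
    then show "\<bar>blinfun_apply f x\<bar> / norm x \<le> dist f z"
      using False by (simp add: field_simps)
  qed (use span_zero in blast)
  then show ?thesis using False by (simp add: field_simps)
qed (simp add: blinfun.zero_right)

lemma infdist_span_pos:
  fixes f :: "'a::real_normed_vector dual"
  assumes "finite G" and "f \<notin> span G"
  shows "infdist f (span G) > 0"
proof (rule ccontr)
  assume "\<not> infdist f (span G) > 0"
  then have "infdist f (span G) = 0" using infdist_nonneg[of f "span G"] by simp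
  then have "f \<in> span G"
    using abs_apply_le_infdist_span[of G _ f]
    by (intro in_span_if_vanishes_on_kernels[OF assms(1)]) force
  with assms(2) show False by contradiction
qed

section \<open>The distance as an attained maximum\<close>

lemma reflexive_representation:
  fixes l :: "'a::banach dual \<Rightarrow> real"
  assumes refl: "reflexive_space TYPE('a)" and l: "linear l" "\<And>h. l h \<le> norm h"
  obtains x :: 'a where "norm x \<le> 1" and "\<And>h. l h = blinfun_apply h x"
proof -
  obtain x :: 'a where x: "Blinfun l = canonical_embedding x"
    using refl unfolding reflexive_space_def by (meson surjD)
  have "blinfun_apply (Blinfun l) = l"
    by (rule bounded_linear_Blinfun_apply) (rule linear_le_norm_bounded_linear[OF l])
  then have eq: "l h = blinfun_apply h x" for h
    unfolding x by (metis canonical_embedding.rep_eq)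
  obtain h :: "'a dual" where "norm h \<le> 1" "blinfun_apply h x = norm x"
    by (rule norming_functional)
  then have "norm x \<le> 1" using l(2)[of h] eq[of h] by simp
  then show ?thesis using eq by (rule that)
qed

theorem theorem3p6:
  fixes f :: "'a::banach dual" and g :: "nat \<Rightarrow> 'a dual" and n :: nat
  assumes "reflexive_space TYPE('a)"
    and "strictly_convex_space TYPE('a)"
    and "inj_on g {1..n}" and "independent (g ` {1..n})"
    and "f \<notin> span (g ` {1..n})"
  shows "is_max (infdist f (span (g ` {1..n})))
    {\<bar>blinfun_apply f x\<bar> | x. x \<in> (\<Inter>i\<in>{1..n}. functional_kernel (g i)) \<inter> sphere 0 1}"
proof -
  let ?G = "g ` {1..n}"
  let ?d = "\<lambda>h. infdist h (span ?G)"
  have upper: "\<bar>blinfun_apply f x\<bar> \<le> ?d f * norm x"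
    if "x \<in> (\<Inter>i\<in>{1..n}. functional_kernel (g i))" for x
    using that by (intro abs_apply_le_infdist_span) (auto simp: functional_kernel_def)
  obtain l where l: "linear l" "\<And>h. l h \<le> ?d h" "l f = ?d f"
    using Hahn_Banach_norming[OF sublinear_infdist[OF subspace_span[of ?G]], of f] by blast
  \<comment> \<open>\<open>0 \<in> span ?G\<close>, so the distance is dominated by the norm\<close>
  have "?d h \<le> norm h" for h
    using infdist_le[OF span_zero, of h ?G] by simp
  then have "l h \<le> norm h" for h using l(2)[of h] by (rule order_trans[rotated])
  then obtain x where x: "norm x \<le> 1" "\<And>h. l h = blinfun_apply h x"
    using reflexive_representation[OF assms(1) l(1)] by blast
  \<comment> \<open>\<open>l\<close> is dominated by a function that vanishes at \<open>h\<close> and at \<open>- h\<close>\<close>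
  have "blinfun_apply h x = 0" if "h \<in> span ?G" for h
    using l(2)[of h] l(2)[of "- h"] that span_neg[OF that] x(2)
    by (simp add: blinfun.minus_left)
  then have ker: "x \<in> (\<Inter>i\<in>{1..n}. functional_kernel (g i))"
    by (auto simp: functional_kernel_def span_base)
  have fx: "blinfun_apply f x = ?d f" using l(3) x(2) by simp
  have pos: "?d f > 0" by (rule infdist_span_pos) (use assms(5) in auto)
  have "?d f * 1 \<le> ?d f * norm x" using upper[OF ker] fx pos by simp
  then have "1 \<le> norm x" using pos by (simp only: mult_le_cancel_left_pos)
  with x(1) have "x \<in> sphere 0 1" by simp
  with ker fx pos have "?d f \<in> {\<bar>blinfun_apply f x\<bar> | x.
      x \<in> (\<Inter>i\<in>{1..n}. functional_kernel (g i)) \<inter> sphere 0 1}"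
    by (intro CollectI exI[of _ x]) auto
  moreover have "s \<le> ?d f" if "s \<in> {\<bar>blinfun_apply f x\<bar> | x.
      x \<in> (\<Inter>i\<in>{1..n}. functional_kernel (g i)) \<inter> sphere 0 1}" for s
    using that upper by force
  ultimately show ?thesis unfolding is_max_def by blast
qed

end
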